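(* Let $\mathcal{M}$ be a factor acting on a Hilbert space $H$, let $x\in H$ be a unit vector which is separating and cyclic for $\mathcal{M}$, and let $E\in B(H)$ be the rank one projection onto $\mathbb{C}x$. Let $k\in\mathbb{N}$, $A_1,\dots,A_k,B_1,\dots,B_k\in\mathcal{M}$, let $\phi\colon\mathcal{M}\to\mathcal{M}$ be defined by $\phi(C)=\sum_{i=1}^k A_iCB_i$, and let $D_\phi=\sum_{i=1}^k B_iEA_i\in B(H)$. Then $\phi\geq 0$ if and only if $\mathrm{Tr}(D_\phi CD')\geq 0$ for all positive operators $C\in\mathcal{M}$ and $D'\in\mathcal{M}'$.
   Context: A factor is a von Neumann algebra with trivial center; $\mathcal{M}'$ denotes the commutant of $\mathcal{M}$ in $B(H)$. A vector $x$ is cyclic for $\mathcal{M}$ if $\mathcal{M}x$ is dense in $H$, and separating if $A\in\mathcal{M}$, $Ax=0$ imply $A=0$. $\mathrm{Tr}$ is the usual trace on $B(H)$ (note that $D_\phi$ has finite rank). $\phi\geq 0$ means that $\phi$ is positive, i.e. $\phi(C)\geq 0$ whenever $C\in\mathcal{M}$, $C\geq 0$. *)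

theory Defs
  imports "HOL-Analysis.Analysis"
begin

text \<open>
  Complex Hilbert spaces of arbitrary dimension. The class extends \<open>real_inner\<close>, the real inner
  product being the real part of the complex one, so that norm and topology are the usual ones:
  \<open>(norm x)\<^sup>2 = inner x x = cinner x x\<close>, and positive definiteness of \<open>cinner\<close> is that of \<open>inner\<close>.
  The complex inner product is linear in its first argument.
\<close>

class complex_hilbert_space = real_inner + complete_space +
  fixes scaleC :: "complex \<Rightarrow> 'a \<Rightarrow> 'a" (infixr "*\<^sub>C" 75)
    and cinner :: "'a \<Rightarrow> 'a \<Rightarrow> complex"
  assumes scaleC_add_right: "c *\<^sub>C (x + y) = c *\<^sub>C x + c *\<^sub>C y"
    and scaleC_add_left: "(c + d) *\<^sub>C x = c *\<^sub>C x + d *\<^sub>C x"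
    and scaleC_scaleC: "c *\<^sub>C d *\<^sub>C x = (c * d) *\<^sub>C x"
    and scaleR_eq_scaleC: "r *\<^sub>R x = complex_of_real r *\<^sub>C x"
    and cinner_commute: "cinner x y = cnj (cinner y x)"
    and cinner_add_left: "cinner (x + y) z = cinner x z + cinner y z"
    and cinner_scaleC_left: "cinner (c *\<^sub>C x) y = c * cinner x y"
    and inner_eq_Re_cinner: "inner x y = Re (cinner x y)"

lemma cinner_self: "cinner x x = complex_of_real ((norm x)\<^sup>2)"
  for x :: "'a::complex_hilbert_space"
proof (rule complex_eqI)
  show "Re (cinner x x) = Re (complex_of_real ((norm x)\<^sup>2))"
    by (simp add: power2_norm_eq_inner inner_eq_Re_cinner)
  have "Im (cinner x x) = - Im (cinner x x)"
    by (subst cinner_commute) simp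
  then show "Im (cinner x x) = Im (complex_of_real ((norm x)\<^sup>2))"
    by simp
qed

instantiation complex :: complex_hilbert_space
begin

definition scaleC_complex :: "complex \<Rightarrow> complex \<Rightarrow> complex"
  where "scaleC_complex c z = c * z"

definition cinner_complex :: "complex \<Rightarrow> complex \<Rightarrow> complex"
  where "cinner_complex z w = z * cnj w"

instance
  by standard
    (simp_all add: scaleC_complex_def cinner_complex_def inner_complex_def
      scaleR_conv_of_real algebra_simps)

end

text \<open>
  Operators are elements of the library type \<open>'a \<Rightarrow>\<^sub>L 'a\<close>, whose members are only real linear;
  \<open>BH\<close> is the algebra of those that are complex linear.
\<close>

definition BH :: "('a::complex_hilbert_space \<Rightarrow>\<^sub>L 'a) set"
  where "BH = {A :: 'a \<Rightarrow>\<^sub>L 'a. \<forall>c x. A (c *\<^sub>C x) = c *\<^sub>C A x}"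

definition cadjoint :: "('a::complex_hilbert_space \<Rightarrow>\<^sub>L 'a) \<Rightarrow> ('a \<Rightarrow>\<^sub>L 'a)"
  where "cadjoint A = (THE B. B \<in> BH \<and> (\<forall>x y. cinner (A x) y = cinner x (B y)))"

definition positive_op :: "('a::complex_hilbert_space \<Rightarrow>\<^sub>L 'a) \<Rightarrow> bool"
  where "positive_op A \<longleftrightarrow> A \<in> BH \<and> (\<forall>y. cinner (A y) y \<in> \<real>\<^sub>\<ge>\<^sub>0)"

definition projection_onto :: "('a::complex_hilbert_space \<Rightarrow>\<^sub>L 'a) \<Rightarrow> 'a set \<Rightarrow> bool"
  where "projection_onto P S \<longleftrightarrow>
    P \<in> BH \<and> P o\<^sub>L P = P \<and> cadjoint P = P \<and> range (blinfun_apply P) = S"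

definition commutant :: "('a::complex_hilbert_space \<Rightarrow>\<^sub>L 'a) set \<Rightarrow> ('a \<Rightarrow>\<^sub>L 'a) set"
  where "commutant M = {T \<in> BH. \<forall>A\<in>M. T o\<^sub>L A = A o\<^sub>L T}"

text \<open>
  The bicommutant form of the definition. That \<open>M\<close> is a unital subalgebra of \<open>BH\<close>, closed in the
  weak operator topology, is implied, since every commutant is one.
\<close>

definition von_neumann_algebra :: "('a::complex_hilbert_space \<Rightarrow>\<^sub>L 'a) set \<Rightarrow> bool"
  where "von_neumann_algebra M \<longleftrightarrow>
    (\<forall>A\<in>M. cadjoint A \<in> M) \<and> commutant (commutant M) = M"

definition factor :: "('a::complex_hilbert_space \<Rightarrow>\<^sub>L 'a) set \<Rightarrow> bool"
  where "factor M \<longleftrightarrow>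
    von_neumann_algebra M \<and> M \<inter> commutant M = {Z :: 'a \<Rightarrow>\<^sub>L 'a. \<exists>c. \<forall>y. Z y = c *\<^sub>C y}"

definition cyclic_vector :: "('a::complex_hilbert_space \<Rightarrow>\<^sub>L 'a) set \<Rightarrow> 'a \<Rightarrow> bool"
  where "cyclic_vector M x \<longleftrightarrow> closure ((\<lambda>A. blinfun_apply A x) ` M) = UNIV"

definition separating_vector :: "('a::complex_hilbert_space \<Rightarrow>\<^sub>L 'a) set \<Rightarrow> 'a \<Rightarrow> bool"
  where "separating_vector M x \<longleftrightarrow> (\<forall>A\<in>M. blinfun_apply A x = 0 \<longrightarrow> A = 0)"

definition positive_map ::
  "('a::complex_hilbert_space \<Rightarrow>\<^sub>L 'a) set \<Rightarrow> (('a \<Rightarrow>\<^sub>L 'a) \<Rightarrow> ('a \<Rightarrow>\<^sub>L 'a)) \<Rightarrow> bool"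
  where "positive_map M \<phi> \<longleftrightarrow> (\<forall>C\<in>M. positive_op C \<longrightarrow> positive_op (\<phi> C))"

definition orthonormal_set :: "'a::complex_hilbert_space set \<Rightarrow> bool"
  where "orthonormal_set S \<longleftrightarrow>
    (\<forall>e\<in>S. norm e = 1) \<and> (\<forall>e\<in>S. \<forall>f\<in>S. e \<noteq> f \<longrightarrow> cinner e f = 0)"

text \<open>An orthonormal basis in the Hilbert space sense is a maximal orthonormal set.\<close>

definition orthonormal_basis :: "'a::complex_hilbert_space set \<Rightarrow> bool"
  where "orthonormal_basis S \<longleftrightarrow>
    orthonormal_set S \<and> (\<forall>S'. orthonormal_set S' \<and> S \<subseteq> S' \<longrightarrow> S' = S)"

text \<open>
  Meaningful for trace class operators only, in particular for those of finite rank: for these the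
  sum converges absolutely and does not depend on the orthonormal basis.
\<close>

definition op_trace :: "('a::complex_hilbert_space \<Rightarrow>\<^sub>L 'a) \<Rightarrow> complex"
  where "op_trace T = (\<Sum>\<^sub>\<infinity>e\<in>(SOME S. orthonormal_basis S). cinner (T e) e)"

end

theory Submission
  imports Defs
begin

text \<open>
  Since \<open>E y = \<langle>y, x\<rangle> x\<close> and \<open>D'\<close> commutes with \<open>M\<close>, the trace \<open>Tr (D C D')\<close> equals
  \<open>\<langle>\<phi>(C) D' x, x\<rangle>\<close>. If \<open>\<phi>(C)\<close> is positive, this is nonnegative because \<open>\<phi>(C)\<close> and \<open>D'\<close> are commuting
  positive operators. Conversely, taking \<open>D' = T\<^sup>* T\<close> with \<open>T\<close> in the commutant gives
  \<open>\<langle>\<phi>(C) T x, T x\<rangle> \<ge> 0\<close>, and the vectors \<open>T x\<close> are dense because \<open>x\<close> is separating for \<open>M\<close>: the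
  projection onto their closed span belongs to the bicommutant \<open>M\<close> and fixes \<open>x\<close>.
\<close>

section \<open>Orthogonality in real Hilbert spaces\<close>

text \<open>Along a minimizing sequence in \<open>V\<close>, the parallelogram law forces the Cauchy
  property because midpoints stay in \<open>V\<close>; completeness and closedness then place the
  limit in \<open>V\<close>.\<close>

lemma minimizing_in_subspace:
  fixes V :: "'a::{real_inner, complete_space} set"
  assumes "closed V" and V: "subspace V"
  shows "\<exists>p\<in>V. \<forall>v\<in>V. (norm (y - p))\<^sup>2 \<le> (norm (y - v))\<^sup>2"
proof -
  define d where "d = (INF v\<in>V. (norm (y - v))\<^sup>2)"
  have ne: "V \<noteq> {}"
    using subspace_0[OF V] by auto
  have bdd: "bdd_below ((\<lambda>v. (norm (y - v))\<^sup>2) ` V)"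
    by (rule bdd_belowI2[of _ 0]) simp
  have d_le: "d \<le> (norm (y - v))\<^sup>2" if "v \<in> V" for v
    unfolding d_def by (rule cINF_lower[OF bdd that])
  have "\<exists>v\<in>V. (norm (y - v))\<^sup>2 < d + inverse (real (Suc n))" for n
    using cINF_less_iff[OF ne bdd, of "d + inverse (real (Suc n))"] by (simp add: d_def)
  then obtain u where uV: "\<And>n. u n \<in> V"
    and u: "\<And>n. (norm (y - u n))\<^sup>2 < d + inverse (real (Suc n))"
    by metis
  have dist_u: "(norm (u m - u n))\<^sup>2 \<le> 2 * inverse (real (Suc m)) + 2 * inverse (real (Suc n))" for m n
  proof -
    have "(1/2) *\<^sub>R (u m + u n) \<in> V"
      by (intro subspace_scale subspace_add V uV)
    then have "d \<le> (norm (y - (1/2) *\<^sub>R (u m + u n)))\<^sup>2"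
      by (rule d_le)
    moreover have "(norm (u m - u n))\<^sup>2 =
        2 * (norm (y - u m))\<^sup>2 + 2 * (norm (y - u n))\<^sup>2 - 4 * (norm (y - (1/2) *\<^sub>R (u m + u n)))\<^sup>2"
      by (simp add: power2_norm_eq_inner inner_diff_left inner_diff_right inner_add_left
          inner_add_right inner_commute algebra_simps)
    ultimately show ?thesis
      using u[of m] u[of n] by linarith
  qed
  have "Cauchy u"
  proof (rule metric_CauchyI)
    fix e :: real
    assume "0 < e"
    \<comment> \<open>For two indices beyond \<open>N\<close> the bound \<open>dist_u\<close> is at
      most \<open>4 * inverse (real (Suc N))\<close>, hence the choice
      \<open>e\<^sup>2 / 4\<close>.\<close>
    then obtain N where N: "inverse (real (Suc N)) < e\<^sup>2 / 4"
      using reals_Archimedean[of "e\<^sup>2 / 4"] by auto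
    have "dist (u m) (u n) < e" if "m \<ge> N" "n \<ge> N" for m n
    proof -
      have "inverse (real (Suc m)) \<le> inverse (real (Suc N))"
        "inverse (real (Suc n)) \<le> inverse (real (Suc N))"
        using that by (simp_all add: le_imp_inverse_le)
      then have "(norm (u m - u n))\<^sup>2 < e\<^sup>2"
        using dist_u[of m n] N by linarith
      then show ?thesis
        using \<open>0 < e\<close> by (simp add: dist_norm power_less_imp_less_base)
    qed
    then show "\<exists>N. \<forall>m\<ge>N. \<forall>n\<ge>N. dist (u m) (u n) < e"
      by blast
  qed
  then obtain p where p: "u \<longlonglongrightarrow> p"
    by (auto simp: Cauchy_convergent_iff convergent_def)
  have "p \<in> V"
    using closed_sequentially[OF \<open>closed V\<close> _ p] uV by blast
  have "(\<lambda>n. (norm (y - u n))\<^sup>2) \<longlonglongrightarrow> (norm (y - p))\<^sup>2"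
    by (intro tendsto_intros p)
  moreover have "(\<lambda>n. d + inverse (real (Suc n))) \<longlonglongrightarrow> d + 0"
    by (intro tendsto_intros LIMSEQ_inverse_real_of_nat)
  ultimately have "(norm (y - p))\<^sup>2 \<le> d + 0"
    by (rule LIMSEQ_le) (use u less_imp_le in blast)
  then have "(norm (y - p))\<^sup>2 \<le> (norm (y - v))\<^sup>2" if "v \<in> V" for v
    using d_le[OF that] by linarith
  then show ?thesis
    using \<open>p \<in> V\<close> by blast
qed

text \<open>A closest point \<open>p\<close> works: if \<open>y - p\<close> had a component along
  some \<open>v\<close> in \<open>V\<close>, moving \<open>p\<close> in that direction would reduce
  the distance.\<close>

lemma orthogonal_decomposition:
  fixes V :: "'a::{real_inner, complete_space} set"
  assumes "closed V" and V: "subspace V"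
  shows "\<exists>p\<in>V. \<forall>v\<in>V. inner (y - p) v = 0"
proof -
  obtain p where "p \<in> V" and min: "\<And>v. v \<in> V \<Longrightarrow> (norm (y - p))\<^sup>2 \<le> (norm (y - v))\<^sup>2"
    using minimizing_in_subspace[OF assms] by blast
  have "inner (y - p) v = 0" if "v \<in> V" for v
  proof (cases "v = 0")
    case False
    \<comment> \<open>This is the coefficient for which \<open>y - p - t *\<^sub>R v\<close> has
      least norm; comparison with the coefficient 0 leaves
      \<open>(inner (y - p) v)\<^sup>2 / inner v v \<le> 0\<close>.\<close>
    define t where "t = inner (y - p) v / inner v v"
    have "p + t *\<^sub>R v \<in> V"
      by (intro subspace_add subspace_scale V \<open>p \<in> V\<close> that)
    then have "(norm (y - p))\<^sup>2 \<le> (norm (y - p - t *\<^sub>R v))\<^sup>2"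
      using min by (simp add: diff_diff_add)
    also have "\<dots> = (norm (y - p))\<^sup>2 - 2 * t * inner (y - p) v + t * (t * inner v v)"
      by (simp only: power2_norm_eq_inner inner_diff_left[of "y - p"] inner_diff_right[of _ "y - p"]
          inner_scaleR_left inner_scaleR_right inner_commute[of v "y - p"]) (simp add: algebra_simps)
    also have "t * inner v v = inner (y - p) v"
      using False by (simp add: t_def)
    finally have "t * inner (y - p) v \<le> 0"
      by simp
    then have "(inner (y - p) v)\<^sup>2 / inner v v \<le> 0"
      by (simp add: t_def power2_eq_square)
    then show ?thesis
      using False by (simp add: divide_le_0_iff flip: power2_norm_eq_inner)
  qed simp
  with \<open>p \<in> V\<close> show ?thesis
    by blast
qed

text \<open>The difference \<open>p - q\<close> lies in \<open>V\<close> and is orthogonal to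
  \<open>V\<close>, hence to itself. Linearity of projections and their commutation with operators
  come from this uniqueness.\<close>

lemma orthogonal_decomposition_unique:
  fixes y :: "'a::real_inner"
  assumes "subspace V" and p: "p \<in> V" "\<And>v. v \<in> V \<Longrightarrow> inner (y - p) v = 0"
    and q: "q \<in> V" "\<And>v. v \<in> V \<Longrightarrow> inner (y - q) v = 0"
  shows "p = q"
proof -
  have "p - q \<in> V"
    by (intro subspace_diff assms)
  then have "inner (y - q) (p - q) - inner (y - p) (p - q) = 0"
    using p q by simp
  then show ?thesis
    by (simp flip: inner_diff_left)
qed

lemma subspace_closure:
  fixes U :: "'a::real_normed_vector set"
  assumes "subspace U"
  shows "subspace (closure U)"
proof (rule subspaceI)
  show "0 \<in> closure U"
    using subspace_0[OF assms] closure_subset by blast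
next
  fix v w
  assume "v \<in> closure U" "w \<in> closure U"
  then obtain a b where ab: "\<And>n. a n \<in> U" "\<And>n. b n \<in> U" and "a \<longlonglongrightarrow> v" "b \<longlonglongrightarrow> w"
    unfolding closure_sequential by blast
  then have "(\<lambda>n. a n + b n) \<longlonglongrightarrow> v + w" and "\<And>n. a n + b n \<in> U"
    by (auto intro: tendsto_add subspace_add[OF assms])
  then show "v + w \<in> closure U"
    unfolding closure_sequential by (intro exI[of _ "\<lambda>n. a n + b n"] conjI allI)
next
  fix r v
  assume "v \<in> closure U"
  then obtain a where "\<And>n. a n \<in> U" and "a \<longlonglongrightarrow> v"
    unfolding closure_sequential by blast
  then have "(\<lambda>n. r *\<^sub>R a n) \<longlonglongrightarrow> r *\<^sub>R v" and "\<And>n. r *\<^sub>R a n \<in> U"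
    by (auto intro: tendsto_scaleR subspace_scale[OF assms])
  then show "r *\<^sub>R v \<in> closure U"
    unfolding closure_sequential by (intro exI[of _ "\<lambda>n. r *\<^sub>R a n"] conjI allI)
qed

text \<open>For nonzero \<open>f\<close>, take a vector \<open>w\<close> orthogonal to the closed
  kernel with \<open>f w\<close> nonzero. Every \<open>y\<close> differs from
  \<open>(f y / f w) *\<^sub>R w\<close> by an element of the kernel, so a multiple of
  \<open>w\<close> represents \<open>f\<close>.\<close>

lemma riesz_representation:
  fixes f :: "'a::{real_inner, complete_space} \<Rightarrow> real"
  assumes "bounded_linear f"
  shows "\<exists>z. \<forall>y. f y = inner y z"
proof (cases "\<forall>y. f y = 0")
  case True
  then show ?thesis
    by (intro exI[of _ 0]) simp
next
  case False
  interpret f: bounded_linear f by fact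
  obtain y0 where "f y0 \<noteq> 0"
    using False by blast
  let ?V = "{y. f y = 0}"
  have "subspace ?V"
    by (auto simp: subspace_def f.zero f.add f.scaleR)
  moreover have "closed ?V"
    by (intro closed_Collect_eq continuous_intros f.continuous_on)
  ultimately obtain p where "f p = 0" and orth: "\<And>v. f v = 0 \<Longrightarrow> inner (y0 - p) v = 0"
    using orthogonal_decomposition[of ?V y0] by auto
  define w where "w = y0 - p"
  have fw: "f w \<noteq> 0"
    using \<open>f y0 \<noteq> 0\<close> \<open>f p = 0\<close> by (simp add: w_def f.diff)
  then have "w \<noteq> 0"
    using f.zero by auto
  have "f y = inner y ((f w / inner w w) *\<^sub>R w)" for y
  proof -
    have "f (y - (f y / f w) *\<^sub>R w) = 0"
      using fw by (simp add: f.diff f.scaleR)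
    then have "inner w (y - (f y / f w) *\<^sub>R w) = 0"
      unfolding w_def by (rule orth)
    then have "inner w y = f y / f w * inner w w"
      by (simp add: inner_diff_right)
    then show ?thesis
      using fw \<open>w \<noteq> 0\<close> by (simp add: inner_commute)
  qed
  then show ?thesis
    by blast
qed

lemma inner_left_eqI:
  fixes a b :: "'a::real_inner"
  assumes "\<And>y. inner y a = inner y b"
  shows "a = b"
proof -
  have "inner (a - b) (a - b) = 0"
    using assms[of "a - b"] by (simp add: inner_diff_right)
  then show ?thesis
    by simp
qed

text \<open>The Riesz representation of \<open>inner (A y) z\<close> as a functional of
  \<open>y\<close> gives the value of the adjoint at \<open>z\<close>; nondegeneracy makes it linear
  in \<open>z\<close>, and Cauchy-Schwarz bounds it by \<open>norm A\<close>.\<close>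

lemma bounded_linear_adjoint_exists:
  fixes A :: "'a::{real_inner, complete_space} \<Rightarrow>\<^sub>L 'a"
  shows "\<exists>B :: 'a \<Rightarrow>\<^sub>L 'a. \<forall>y z. inner (A y) z = inner y (B z)"
proof -
  have "\<exists>w. \<forall>y. inner (A y) z = inner y w" for z
    by (rule riesz_representation)
      (intro bounded_linear_compose[OF bounded_linear_inner_left] blinfun.bounded_linear_right)
  then obtain g where g: "\<And>y z. inner (A y) z = inner y (g z)"
    by metis
  have "bounded_linear g"
  proof (rule bounded_linear_intro[where K = "norm A"])
    show "g (a + b) = g a + g b" for a b
      by (rule inner_left_eqI) (simp add: inner_add_right flip: g)
    show "g (r *\<^sub>R a) = r *\<^sub>R g a" for r a
      by (rule inner_left_eqI) (simp flip: g)
    show "norm (g a) \<le> norm a * norm A" for a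
    proof (cases "g a = 0")
      case False
      have "norm (g a) * norm (g a) = inner (A (g a)) a"
        by (simp add: g flip: power2_norm_eq_inner power2_eq_square)
      also have "\<dots> \<le> norm (A (g a)) * norm a"
        by (rule norm_cauchy_schwarz)
      also have "\<dots> \<le> (norm A * norm (g a)) * norm a"
        by (intro mult_right_mono norm_blinfun norm_ge_zero)
      finally show ?thesis
        using False by (simp add: ac_simps)
    qed simp
  qed
  then show ?thesis
    by (intro exI[of _ "Blinfun g"]) (simp add: bounded_linear_Blinfun_apply g)
qed

text \<open>Uniqueness of the decomposition makes the choice of nearest points linear, and
  orthogonality of \<open>y - g y\<close> to \<open>g y\<close> makes it a contraction.\<close>

lemma orthogonal_projection_exists:
  fixes V :: "'a::{real_inner, complete_space} set"
  assumes "closed V" and V: "subspace V"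
  shows "\<exists>P :: 'a \<Rightarrow>\<^sub>L 'a. \<forall>y. P y \<in> V \<and> (\<forall>v\<in>V. inner (y - P y) v = 0)"
proof -
  obtain g where gV: "\<And>y. g y \<in> V" and g: "\<And>y v. v \<in> V \<Longrightarrow> inner (y - g y) v = 0"
    using orthogonal_decomposition[OF assms] by metis
  have uniq: "g y = q" if "q \<in> V" and "\<And>v. v \<in> V \<Longrightarrow> inner (y - q) v = 0" for y q
    by (rule orthogonal_decomposition_unique[OF V gV g that])
  have "bounded_linear g"
  proof (rule bounded_linear_intro[where K = 1])
    show "g (a + b) = g a + g b" for a b
    proof (rule uniq)
      fix v assume "v \<in> V"
      then show "inner (a + b - (g a + g b)) v = 0"
        using g[of v a] g[of v b] by (simp add: inner_diff_left inner_add_left)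
    qed (intro subspace_add V gV)
    show "g (r *\<^sub>R a) = r *\<^sub>R g a" for r a
      by (rule uniq) (use g in \<open>auto intro!: subspace_scale V gV simp flip: scaleR_diff_right\<close>)
    show "norm (g a) \<le> norm a * 1" for a
    proof (cases "g a = 0")
      case False
      have "norm (g a) * norm (g a) = inner a (g a)"
        using g[OF gV, of a a] by (simp add: inner_diff_left flip: power2_norm_eq_inner power2_eq_square)
      also have "\<dots> \<le> norm a * norm (g a)"
        by (rule norm_cauchy_schwarz)
      finally show ?thesis
        using False by simp
    qed simp
  qed
  then show ?thesis
    using gV g by (intro exI[of _ "Blinfun g"]) (simp add: bounded_linear_Blinfun_apply)
qed

section \<open>Products of commuting positive operators\<close>

text \<open>F. Riesz's replacement for the square root: if \<open>0 \<le> A \<le> 1\<close>, then iterating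
  \<open>T \<mapsto> T - T\<^sup>2\<close> from \<open>A\<close> gives operators \<open>A\<^sub>n\<close> with \<open>\<Sum>A\<^sub>n\<^sup>2 = A\<close> strongly.\<close>

primrec riesz_seq :: "('a::real_normed_vector \<Rightarrow>\<^sub>L 'a) \<Rightarrow> nat \<Rightarrow> ('a \<Rightarrow>\<^sub>L 'a)"
  where "riesz_seq A 0 = A"
  | "riesz_seq A (Suc n) = riesz_seq A n - (riesz_seq A n o\<^sub>L riesz_seq A n)"

lemma riesz_seq_symmetric:
  fixes A :: "'a::real_inner \<Rightarrow>\<^sub>L 'a"
  assumes "\<And>y z. inner (A y) z = inner y (A z)"
  shows "inner (riesz_seq A n y) z = inner y (riesz_seq A n z)"
  by (induction n arbitrary: y z)
    (simp_all add: assms blinfun.diff_left inner_diff_left inner_diff_right)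

lemma riesz_seq_commute:
  fixes A B :: "'a::real_normed_vector \<Rightarrow>\<^sub>L 'a"
  assumes "\<And>y. A (B y) = B (A y)"
  shows "riesz_seq A n (B y) = B (riesz_seq A n y)"
  by (induction n arbitrary: y) (simp_all add: assms blinfun.diff_left blinfun.diff_right)

lemma riesz_seq_bounds:
  fixes A :: "'a::real_inner \<Rightarrow>\<^sub>L 'a"
  assumes sym: "\<And>y z. inner (A y) z = inner y (A z)"
    and "\<And>y. 0 \<le> inner (A y) y" and "\<And>y. inner (A y) y \<le> inner y y"
  shows "0 \<le> inner (riesz_seq A n y) y \<and> inner (riesz_seq A n y) y \<le> inner y y"
proof (induction n arbitrary: y)
  case 0
  then show ?case
    using assms by simp
next
  case (Suc n)
  let ?T = "riesz_seq A n"
  note T = riesz_seq_symmetric[OF sym, of n]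
  let ?w = "y - ?T y"
  have T2: "inner (?T (?T y)) y = inner (?T y) (?T y)"
    by (simp add: T)
  \<comment> \<open>\<open>T - T\<^sup>2 = T (1 - T) T + (1 - T) T (1 - T)\<close>\<close>
  have "inner (riesz_seq A (Suc n) y) y =
      (inner (?T y) (?T y) - inner (?T (?T y)) (?T y)) + inner (?T ?w) ?w"
    by (simp add: blinfun.diff_left blinfun.diff_right inner_diff_left inner_diff_right T2
        inner_commute T)
  moreover have "inner (riesz_seq A (Suc n) y) y = inner (?T y) y - inner (?T y) (?T y)"
    by (simp add: blinfun.diff_left inner_diff_left T2)
  ultimately show ?case
    using Suc[of "?T y"] Suc[of ?w] Suc[of y] inner_ge_zero[of "?T y"] by linarith
qed

text \<open>The sum telescopes, since each square is the difference of two consecutive members of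
  the sequence.\<close>

lemma riesz_seq_square_sum:
  "(\<Sum>i<n. riesz_seq A i (riesz_seq A i y)) = A y - riesz_seq A n y"
  by (induction n) (simp_all add: blinfun.diff_left)

text \<open>Write \<open>A\<^sub>i\<close> for \<open>riesz_seq A i\<close>. The sum of the squared
  norms of \<open>A\<^sub>i y\<close> is bounded by \<open>inner (A y) y\<close>, so
  \<open>A\<^sub>n y\<close> tends to 0 and the squares sum strongly to \<open>A\<close>. As
  \<open>A\<^sub>i\<close> is symmetric and commutes with \<open>B\<close>, each square contributes
  \<open>inner (B (A\<^sub>i y)) (A\<^sub>i y)\<close>, which is nonnegative.\<close>

lemma inner_commuting_positive_contraction:
  fixes A B :: "'a::real_inner \<Rightarrow>\<^sub>L 'a"
  assumes sym: "\<And>y z. inner (A y) z = inner y (A z)"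
    and pos: "\<And>y. 0 \<le> inner (A y) y" and le: "\<And>y. inner (A y) y \<le> inner y y"
    and B: "\<And>y. 0 \<le> inner (B y) y"
    and comm: "\<And>y. A (B y) = B (A y)"
  shows "0 \<le> inner (A (B y)) y"
proof -
  note T = riesz_seq_symmetric[OF sym] and bounds = riesz_seq_bounds[OF sym pos le]
  have "(\<Sum>i<n. (norm (riesz_seq A i y))\<^sup>2) \<le> inner (A y) y" for n
  proof -
    have "(\<Sum>i<n. (norm (riesz_seq A i y))\<^sup>2) = inner (\<Sum>i<n. riesz_seq A i (riesz_seq A i y)) y"
      by (simp add: inner_sum_left power2_norm_eq_inner T)
    also have "\<dots> \<le> inner (A y) y"
      using bounds[of n y] by (simp add: riesz_seq_square_sum inner_diff_left)
    finally show ?thesis .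
  qed
  then have "summable (\<lambda>i. (norm (riesz_seq A i y))\<^sup>2)"
    by (intro summableI_nonneg_bounded) auto
  then have "(\<lambda>i. sqrt ((norm (riesz_seq A i y))\<^sup>2)) \<longlonglongrightarrow> sqrt 0"
    by (intro tendsto_real_sqrt summable_LIMSEQ_zero)
  then have "(\<lambda>i. riesz_seq A i y) \<longlonglongrightarrow> 0"
    by (simp add: tendsto_norm_zero_iff)
  then have "(\<lambda>n. inner (B (A y - riesz_seq A n y)) y) \<longlonglongrightarrow> inner (B (A y - 0)) y"
    by (intro tendsto_intros)
  moreover have "0 \<le> inner (B (A y - riesz_seq A n y)) y" for n
  proof -
    have "inner (B (A y - riesz_seq A n y)) y =
        (\<Sum>i<n. inner (B (riesz_seq A i (riesz_seq A i y))) y)"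
      by (simp add: blinfun.sum_right inner_sum_left flip: riesz_seq_square_sum)
    also have "\<dots> = (\<Sum>i<n. inner (B (riesz_seq A i y)) (riesz_seq A i y))"
      by (simp add: T flip: riesz_seq_commute[OF comm])
    also have "\<dots> \<ge> 0"
      by (intro sum_nonneg B)
    finally show ?thesis .
  qed
  ultimately have "0 \<le> inner (B (A y - 0)) y"
    by (intro LIMSEQ_le_const) auto
  then show ?thesis
    by (simp add: comm)
qed

text \<open>Scaling by \<open>inverse (norm A)\<close> reduces the claim to a contraction.\<close>

lemma inner_commuting_positive:
  fixes A B :: "'a::real_inner \<Rightarrow>\<^sub>L 'a"
  assumes sym: "\<And>y z. inner (A y) z = inner y (A z)"
    and pos: "\<And>y. 0 \<le> inner (A y) y"
    and B: "\<And>y. 0 \<le> inner (B y) y"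
    and comm: "\<And>y. A (B y) = B (A y)"
  shows "0 \<le> inner (A (B y)) y"
proof (cases "A = 0")
  case False
  define r where "r = inverse (norm A)"
  have r: "0 < r"
    using False by (simp add: r_def)
  have "0 \<le> inner ((r *\<^sub>R A) (B y)) y"
  proof (rule inner_commuting_positive_contraction)
    show "inner ((r *\<^sub>R A) z) z \<le> inner z z" for z
    proof -
      have "inner (A z) z \<le> norm (A z) * norm z"
        by (rule norm_cauchy_schwarz)
      also have "\<dots> \<le> norm A * norm z * norm z"
        by (intro mult_right_mono norm_blinfun norm_ge_zero)
      finally have "r * inner (A z) z \<le> r * (norm A * norm z * norm z)"
        using r by (intro mult_left_mono) auto
      also have "\<dots> = inner z z"
        using False by (simp add: r_def power2_eq_square flip: power2_norm_eq_inner)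
      finally show ?thesis
        by (simp add: blinfun.scaleR_left)
    qed
  qed (use r pos in \<open>simp_all add: blinfun.scaleR_left blinfun.scaleR_right B comm, simp add: sym\<close>)
  then show ?thesis
    using r by (simp add: blinfun.scaleR_left zero_le_mult_iff)
qed simp

section \<open>Complex Hilbert spaces\<close>

lemma scaleC_one [simp]: "1 *\<^sub>C x = x"
  for x :: "'a::complex_hilbert_space"
  using scaleR_eq_scaleC[of 1 x] by simp

lemma scaleC_zero_left [simp]: "0 *\<^sub>C x = (0::'a::complex_hilbert_space)"
  using scaleC_add_left[of 0 0 x] by simp

lemma scaleC_zero_right [simp]: "c *\<^sub>C 0 = (0::'a::complex_hilbert_space)"
  using scaleC_add_right[of c 0 0] by simp

lemma scaleC_minus_right: "c *\<^sub>C (- x) = - (c *\<^sub>C x)"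
  for x :: "'a::complex_hilbert_space"
  using scaleC_add_right[of c x "- x"] by (simp add: eq_neg_iff_add_eq_0 add.commute)

lemma scaleC_diff_right: "c *\<^sub>C (x - y) = c *\<^sub>C x - c *\<^sub>C y"
  for x y :: "'a::complex_hilbert_space"
  using scaleC_add_right[of c x "- y"] by (simp add: scaleC_minus_right)

lemma cinner_add_right: "cinner z (x + y) = cinner z x + cinner z y"
  for x y z :: "'a::complex_hilbert_space"
  using cinner_commute[of z "x + y"] cinner_commute[of z x] cinner_commute[of z y]
  by (simp add: cinner_add_left)

lemma cinner_scaleC_right: "cinner y (c *\<^sub>C x) = cnj c * cinner y x"
  for x y :: "'a::complex_hilbert_space"
  using cinner_commute[of y "c *\<^sub>C x"] cinner_commute[of y x]
  by (simp add: cinner_scaleC_left)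

text \<open>The imaginary part is recovered by rotating the first argument by \<open>\<i>\<close>;
  this carries facts about the real inner product over to the complex one.\<close>

lemma cinner_eq_Complex_inner: "cinner x y = Complex (inner x y) (- inner (\<i> *\<^sub>C x) y)"
  for x y :: "'a::complex_hilbert_space"
  by (simp add: complex_eq_iff inner_eq_Re_cinner cinner_scaleC_left)

lemma scaleC_diff_left: "(c - d) *\<^sub>C x = c *\<^sub>C x - d *\<^sub>C x"
  for x :: "'a::complex_hilbert_space"
  using scaleC_add_left[of "c - d" d x] by simp

lemma norm_scaleC: "norm (c *\<^sub>C x) = cmod c * norm x"
  for x :: "'a::complex_hilbert_space"
proof -
  have "complex_of_real ((norm (c *\<^sub>C x))\<^sup>2) = c * cnj c * complex_of_real ((norm x)\<^sup>2)"
    by (simp add: cinner_scaleC_left cinner_scaleC_right del: of_real_power flip: cinner_self)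
  also have "\<dots> = complex_of_real ((cmod c * norm x)\<^sup>2)"
    by (simp only: complex_norm_square[of c] power_mult_distrib of_real_mult)
  finally have "(norm (c *\<^sub>C x))\<^sup>2 = (cmod c * norm x)\<^sup>2"
    by (simp only: of_real_eq_iff)
  then show ?thesis
    by (simp add: power2_eq_iff_nonneg)
qed

lemma bounded_linear_scaleC_right: "bounded_linear (\<lambda>x::'a::complex_hilbert_space. c *\<^sub>C x)"
proof (rule bounded_linear_intro[where K = "cmod c"])
  show "c *\<^sub>C (r *\<^sub>R x) = r *\<^sub>R (c *\<^sub>C x)" for r and x :: 'a
    by (simp add: scaleR_eq_scaleC scaleC_scaleC mult.commute)
qed (simp_all add: scaleC_add_right norm_scaleC mult.commute)

lemma bounded_bilinear_cinner:
  "bounded_bilinear (cinner :: 'a::complex_hilbert_space \<Rightarrow> 'a \<Rightarrow> complex)"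
proof
  show "cinner (r *\<^sub>R a) b = r *\<^sub>R cinner a b" for r and a b :: 'a
    by (simp only: scaleR_eq_scaleC[of r a] cinner_scaleC_left scaleR_conv_of_real)
  show "cinner a (r *\<^sub>R b) = r *\<^sub>R cinner a b" for r and a b :: 'a
    by (simp only: scaleR_eq_scaleC[of r b] cinner_scaleC_right scaleR_conv_of_real)
      simp
  \<comment> \<open>The constant 2 arises from applying the real Cauchy-Schwarz inequality to the
    real and imaginary parts separately.\<close>
  have "norm (cinner a b) \<le> norm a * norm b * 2" for a b :: 'a
    using Cauchy_Schwarz_ineq2[of a b] Cauchy_Schwarz_ineq2[of "\<i> *\<^sub>C a" b]
      cmod_le[of "cinner a b"]
    by (simp add: cinner_eq_Complex_inner norm_scaleC)
  then show "\<exists>K. \<forall>a b::'a. norm (cinner a b) \<le> norm a * norm b * K"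
    by blast
qed (simp_all add: cinner_add_left cinner_add_right)

lemmas tendsto_cinner = bounded_bilinear.tendsto[OF bounded_bilinear_cinner]
  and cinner_diff_left = bounded_bilinear.diff_left[OF bounded_bilinear_cinner]
  and cinner_sum_left = bounded_bilinear.sum_left[OF bounded_bilinear_cinner]
  and cinner_zero_left = bounded_bilinear.zero_left[OF bounded_bilinear_cinner]
  and bounded_linear_cinner_left = bounded_bilinear.bounded_linear_left[OF bounded_bilinear_cinner]

lemma cinner_left_eqI:
  fixes a b :: "'a::complex_hilbert_space"
  assumes "\<And>y. cinner y a = cinner y b"
  shows "a = b"
  by (rule inner_left_eqI) (simp add: inner_eq_Re_cinner assms)

section \<open>Complex linear operators, adjoints and positivity\<close>

lemma BH_scaleC: "A \<in> BH \<Longrightarrow> A (c *\<^sub>C x) = c *\<^sub>C A x"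
  by (simp add: BH_def)

lemma BH_scaleR: "a \<in> BH \<Longrightarrow> r *\<^sub>R a \<in> BH"
  by (simp add: BH_def blinfun.scaleR_left scaleR_eq_scaleC scaleC_scaleC mult.commute)

lemma BH_compose: "A \<in> BH \<Longrightarrow> B \<in> BH \<Longrightarrow> A o\<^sub>L B \<in> BH"
  by (simp add: BH_def)

lemma BH_sum: "(\<And>i. i \<in> I \<Longrightarrow> T i \<in> BH) \<Longrightarrow> (\<Sum>i\<in>I. T i) \<in> BH"
  by (induction I rule: infinite_finite_induct)
    (simp_all add: BH_def blinfun.add_left scaleC_add_right)

text \<open>The definite description in \<open>cadjoint\<close> is meaningful: the real adjoint is
  also the complex one because \<open>A\<close> commutes with multiplication by \<open>\<i>\<close>,
  and nondegeneracy gives complex linearity and uniqueness.\<close>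

lemma cadjoint_works:
  fixes A :: "'a::complex_hilbert_space \<Rightarrow>\<^sub>L 'a"
  assumes "A \<in> BH"
  shows "cadjoint A \<in> BH \<and> (\<forall>y z. cinner (A y) z = cinner y (cadjoint A z))"
  unfolding cadjoint_def
proof (rule theI')
  obtain B :: "'a \<Rightarrow>\<^sub>L 'a" where B: "\<And>y z. inner (A y) z = inner y (B z)"
    using bounded_linear_adjoint_exists by blast
  have cB: "cinner (A y) z = cinner y (B z)" for y z
    using BH_scaleC[OF assms, of \<i> y] B[of "\<i> *\<^sub>C y" z]
    by (simp add: cinner_eq_Complex_inner B)
  have "B (c *\<^sub>C z) = c *\<^sub>C B z" for c z
    by (rule cinner_left_eqI) (simp add: cinner_scaleC_right flip: cB)
  then have "B \<in> BH"
    by (simp add: BH_def)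
  moreover have "T = B" if "\<And>y z. cinner (A y) z = cinner y (T z)" for T :: "'a \<Rightarrow>\<^sub>L 'a"
  proof (rule blinfun_eqI)
    show "T z = B z" for z
      by (rule cinner_left_eqI) (simp flip: cB that)
  qed
  ultimately show "\<exists>!B. B \<in> BH \<and> (\<forall>y z. cinner (A y) z = cinner y (B z))"
    using cB by blast
qed

lemmas cadjoint_BH = cadjoint_works[THEN conjunct1]
  and cinner_cadjoint = cadjoint_works[THEN conjunct2, rule_format]

text \<open>The values \<open>cinner (A y) y\<close> are real and so equal their conjugates.
  Evaluation at \<open>y + z\<close> and at \<open>\<i> *\<^sub>C y + z\<close> yields the sum and
  the difference of the two mixed terms.\<close>

lemma positive_op_symmetric:
  fixes A :: "'a::complex_hilbert_space \<Rightarrow>\<^sub>L 'a"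
  assumes "positive_op A"
  shows "cinner (A y) z = cinner y (A z)"
proof -
  have A: "A \<in> BH" and "cinner (A y) y \<in> \<real>\<^sub>\<ge>\<^sub>0" for y
    using assms by (auto simp: positive_op_def)
  then have "Im (cinner (A y) y) = 0" for y
    by (simp add: complex_nonneg_Reals_iff)
  then have diag: "cinner (A y) y = cinner y (A y)" for y
    using cinner_commute[of y "A y"] by (simp add: complex_eq_iff)
  \<comment> \<open>polarization\<close>
  have "cinner (A y) z + cinner (A z) y = cinner y (A z) + cinner z (A y)"
    using diag[of "y + z"] diag[of y] diag[of z]
    by (simp add: blinfun.add_right cinner_add_left cinner_add_right add.commute)
  moreover have "\<i> * (cinner (A y) z - cinner (A z) y) = \<i> * (cinner y (A z) - cinner z (A y))"
    using diag[of "\<i> *\<^sub>C y + z"] diag[of y] diag[of z] BH_scaleC[OF A]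
    by (simp add: blinfun.add_right cinner_add_left cinner_add_right cinner_scaleC_left
        cinner_scaleC_right algebra_simps)
  then have "cinner (A y) z - cinner (A z) y = cinner y (A z) - cinner z (A y)"
    by (simp only: mult_cancel_left complex_i_not_zero simp_thms)
  ultimately show ?thesis
    by (auto simp: complex_eq_iff)
qed

text \<open>The real part is settled by the real inner product version; the imaginary part vanishes
  because the product of commuting symmetric operators is symmetric.\<close>

lemma cinner_commuting_positive:
  fixes A B :: "'a::complex_hilbert_space \<Rightarrow>\<^sub>L 'a"
  assumes A: "positive_op A" and B: "positive_op B" and comm: "A o\<^sub>L B = B o\<^sub>L A"
  shows "cinner (A (B y)) y \<in> \<real>\<^sub>\<ge>\<^sub>0"
proof -
  have AB: "A (B y) = B (A y)" for y
    using comm by (metis blinfun_apply_blinfun_compose)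
  have pos: "0 \<le> inner (T y) y" if "positive_op T" for T :: "'a \<Rightarrow>\<^sub>L 'a" and y
    using that by (simp add: positive_op_def inner_eq_Re_cinner complex_nonneg_Reals_iff)
  have "0 \<le> inner (A (B y)) y"
    by (rule inner_commuting_positive)
      (use A B AB in \<open>simp_all add: pos, simp add: inner_eq_Re_cinner positive_op_symmetric\<close>)
  moreover have "cinner (A (B y)) y = cnj (cinner (A (B y)) y)"
    using cinner_commute[of "A (B y)" y] A B
    by (simp add: AB positive_op_symmetric)
  then have "Im (cinner (A (B y)) y) = 0"
    by (simp add: complex_eq_iff)
  ultimately show ?thesis
    by (simp add: inner_eq_Re_cinner complex_nonneg_Reals_iff)
qed

section \<open>Orthonormal bases and the trace\<close>

text \<open>Zorn's lemma applies: any two vectors in the union of a chain lie in a common member.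
  Consequently the choice made in \<open>op_trace\<close> is a genuine basis.\<close>

lemma orthonormal_basis_exists: "\<exists>S::'a::complex_hilbert_space set. orthonormal_basis S"
proof -
  have "\<exists>S\<in>{S::'a set. orthonormal_set S}. \<forall>S'\<in>{S. orthonormal_set S}. S \<subseteq> S' \<longrightarrow> S' = S"
  proof (rule subset_Zorn_nonempty)
    show "{S::'a set. orthonormal_set S} \<noteq> {}"
      by (auto simp: orthonormal_set_def intro!: exI[of _ "{}"])
    fix \<C> :: "'a set set"
    assume "\<C> \<noteq> {}" and "subset.chain {S. orthonormal_set S} \<C>"
    then have on: "\<And>X. X \<in> \<C> \<Longrightarrow> orthonormal_set X"
      and chain: "\<And>X Y. X \<in> \<C> \<Longrightarrow> Y \<in> \<C> \<Longrightarrow> X \<subseteq> Y \<or> Y \<subseteq> X"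
      by (auto simp: subset_chain_def)
    have "cinner e f = 0" if "X \<in> \<C>" "Y \<in> \<C>" "e \<in> X" "f \<in> Y" "e \<noteq> f" for X Y e f
      using chain[OF that(1,2)] on[OF that(1)] on[OF that(2)] that(3-5)
      unfolding orthonormal_set_def by blast
    moreover have "norm e = 1" if "X \<in> \<C>" "e \<in> X" for X e
      using on[OF that(1)] that(2) by (simp add: orthonormal_set_def)
    ultimately show "\<Union>\<C> \<in> {S. orthonormal_set S}"
      unfolding orthonormal_set_def by blast
  qed
  then show ?thesis
    by (auto simp: orthonormal_basis_def)
qed

text \<open>A nonzero such \<open>z\<close> could be normalized and adjoined to \<open>S\<close>; by
  maximality it would already lie in \<open>S\<close> and be orthogonal to itself.\<close>

lemma orthonormal_basis_orthogonal_eq_0: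
  assumes S: "orthonormal_basis S" and orth: "\<And>e. e \<in> S \<Longrightarrow> cinner z e = 0"
  shows "z = 0"
proof (rule ccontr)
  assume "z \<noteq> 0"
  define w where "w = inverse (norm z) *\<^sub>R z"
  have w: "cinner w e = 0" "cinner e w = 0" if "e \<in> S" for e
    using orth[OF that] cinner_commute[of e z]
    by (simp_all add: w_def scaleR_eq_scaleC cinner_scaleC_left cinner_scaleC_right)
  have "norm w = 1"
    using \<open>z \<noteq> 0\<close> by (simp add: w_def)
  with w S have "orthonormal_set (insert w S)"
    by (auto simp: orthonormal_basis_def orthonormal_set_def)
  then have "w \<in> S"
    using S by (auto simp: orthonormal_basis_def)
  then have "cinner w w = 0"
    by (rule w)
  then show False
    using \<open>norm w = 1\<close> by (simp add: cinner_self)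
qed

lemma cinner_orthonormal_sum:
  assumes "orthonormal_set S" and "finite F" and "F \<subseteq> S" and "e \<in> F"
  shows "cinner (\<Sum>f\<in>F. c f *\<^sub>C f) e = c e"
proof -
  have "cinner (\<Sum>f\<in>F. c f *\<^sub>C f) e = (\<Sum>f\<in>F. if f = e then c e else 0)"
    unfolding cinner_sum_left
    by (rule sum.cong)
      (use assms in \<open>auto simp: cinner_scaleC_left cinner_self orthonormal_set_def subset_iff\<close>)
  then show ?thesis
    using assms by simp
qed

text \<open>A form of Bessel's inequality: the sum is the orthogonal projection of \<open>w\<close>
  onto the span of \<open>F\<close>.\<close>

lemma norm_orthonormal_sum_le:
  assumes "orthonormal_set S" and "finite F" and "F \<subseteq> S"
  shows "norm (\<Sum>e\<in>F. cinner w e *\<^sub>C e) \<le> norm w"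
proof -
  let ?p = "\<Sum>e\<in>F. cinner w e *\<^sub>C e"
  have "cinner (w - ?p) e = 0" if "e \<in> F" for e
    using cinner_orthonormal_sum[OF assms that] by (simp add: cinner_diff_left)
  then have "cinner (w - ?p) ?p = 0"
    by (simp add: bounded_bilinear.sum_right[OF bounded_bilinear_cinner] cinner_scaleC_right)
  then have "inner (w - ?p) ?p = 0"
    by (simp add: inner_eq_Re_cinner)
  then have "norm ?p * norm ?p = inner w ?p"
    by (simp add: inner_diff_left flip: power2_norm_eq_inner power2_eq_square)
  also have "\<dots> \<le> norm w * norm ?p"
    by (rule norm_cauchy_schwarz)
  finally show ?thesis
    by (cases "?p = 0") simp_all
qed

text \<open>The partial sums are eventually exact on a subspace \<open>U\<close> containing
  \<open>S\<close>. Maximality of \<open>S\<close> makes \<open>U\<close> dense, and since the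
  partial sum maps are contractions, convergence extends from \<open>U\<close> to all
  vectors.\<close>

lemma orthonormal_basis_has_sum:
  fixes b :: "'a::complex_hilbert_space"
  assumes S: "orthonormal_basis S"
  shows "((\<lambda>e. cinner b e *\<^sub>C e) has_sum b) S"
proof -
  let ?p = "\<lambda>F v. \<Sum>e\<in>F. cinner v e *\<^sub>C e"
  let ?\<F> = "finite_subsets_at_top S"
  have on: "orthonormal_set S"
    using S by (simp add: orthonormal_basis_def)
  have ev: "\<forall>\<^sub>F F in ?\<F>. finite F \<and> F \<subseteq> S"
    by (rule eventually_finite_subsets_at_top_weakI) simp
  \<comment> \<open>This set serves as the complex linear span of \<open>S\<close> without any
    handling of coefficients.\<close>
  define U where "U = {v. \<forall>\<^sub>F F in ?\<F>. ?p F v = v}"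
  have U_scaleC: "c *\<^sub>C v \<in> U" if "v \<in> U" for c v
  proof -
    have "?p F (c *\<^sub>C v) = c *\<^sub>C ?p F v" for F
      by (simp add: linear_sum[OF bounded_linear.linear[OF bounded_linear_scaleC_right]]
          cinner_scaleC_left scaleC_scaleC)
    then show ?thesis
      using that by (auto simp: U_def elim: eventually_mono)
  qed
  have "subspace U"
  proof (rule subspaceI)
    show "0 \<in> U"
      by (simp add: U_def cinner_zero_left)
  next
    fix v w assume "v \<in> U" "w \<in> U"
    then show "v + w \<in> U"
      unfolding U_def mem_Collect_eq
      by eventually_elim (simp add: cinner_add_left scaleC_add_left sum.distrib)
  next
    show "r *\<^sub>R v \<in> U" if "v \<in> U" for r v
      using U_scaleC[OF that] by (simp add: scaleR_eq_scaleC)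
  qed
  have SU: "e \<in> U" if "e \<in> S" for e
    unfolding U_def mem_Collect_eq eventually_finite_subsets_at_top
  proof (intro exI[of _ "{e}"] conjI allI impI)
    fix F assume F: "finite F \<and> {e} \<subseteq> F \<and> F \<subseteq> S"
    have "?p F e = (\<Sum>f\<in>F. if f = e then e else 0)"
      by (rule sum.cong)
        (use F on that in \<open>auto simp: orthonormal_set_def cinner_self subset_iff\<close>)
    then show "?p F e = e"
      using F by simp
  qed (use that in auto)
  have "closure U = UNIV"
  proof -
    have "y \<in> closure U" for y
    proof -
      obtain p where p: "p \<in> closure U" "\<And>v. v \<in> closure U \<Longrightarrow> inner (y - p) v = 0"
        using orthogonal_decomposition[of "closure U" y] \<open>subspace U\<close>
        by (auto simp: closed_subspace subspace_closure)
      have "cinner (y - p) e = 0" if "e \<in> S" for e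
      proof -
        \<comment> \<open>The two real equations say that the real and the imaginary part of
          \<open>cinner (y - p) e\<close> vanish.\<close>
        have "inner (y - p) e = 0" "inner (y - p) ((- \<i>) *\<^sub>C e) = 0"
          using p(2) U_scaleC SU[OF that] closure_subset by blast+
        then show ?thesis
          by (simp add: inner_eq_Re_cinner cinner_scaleC_right complex_eq_iff)
      qed
      then have "y - p = 0"
        by (rule orthonormal_basis_orthogonal_eq_0[OF S])
      then show ?thesis
        using p by simp
    qed
    then show ?thesis
      by blast
  qed
  have "((\<lambda>F. ?p F b) \<longlongrightarrow> b) ?\<F>"
  proof (rule tendstoI)
    fix r :: real
    assume "0 < r"
    then obtain v where v: "v \<in> U" "dist v b < r / 2"
      using \<open>closure U = UNIV\<close> closure_approachable[of b U] by (metis UNIV_I half_gt_zero)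
    then have "\<forall>\<^sub>F F in ?\<F>. ?p F v = v"
      by (simp add: U_def)
    with ev show "\<forall>\<^sub>F F in ?\<F>. dist (?p F b) b < r"
    proof eventually_elim
      case (elim F)
      have "?p F b - ?p F v = ?p F (b - v)"
        by (simp add: cinner_diff_left scaleC_diff_left flip: sum_subtractf)
      then have "norm (?p F b - v) \<le> norm (b - v)"
        using norm_orthonormal_sum_le[OF on, of F "b - v"] elim by simp
      then show ?case
        using v(2) dist_triangle[of "?p F b" b v] by (simp add: dist_norm norm_minus_commute)
    qed
  qed
  then show ?thesis
    by (simp add: has_sum_def)
qed

text \<open>The trace of a rank one operator is its functional evaluated at its vector: expand
  \<open>b i\<close> in the basis and apply the bounded, complex linear functional
  \<open>cinner (W i y) x\<close> of \<open>y\<close> term by term.\<close>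

lemma op_trace_finite_rank:
  fixes T :: "'a::complex_hilbert_space \<Rightarrow>\<^sub>L 'a" and W :: "'i \<Rightarrow> 'a \<Rightarrow>\<^sub>L 'a"
  assumes "\<And>i. i \<in> I \<Longrightarrow> W i \<in> BH"
    and T: "\<And>y. T y = (\<Sum>i\<in>I. cinner (W i y) x *\<^sub>C b i)"
  shows "op_trace T = (\<Sum>i\<in>I. cinner (W i (b i)) x)"
proof -
  define S :: "'a set" where "S = (SOME S. orthonormal_basis S)"
  have S: "orthonormal_basis S"
    unfolding S_def by (rule someI_ex) (rule orthonormal_basis_exists)
  have "((\<lambda>e. cinner (W i e) x * cinner (b i) e) has_sum cinner (W i (b i)) x) S" if "i \<in> I" for i
  proof -
    have "bounded_linear (\<lambda>y. cinner (W i y) x)"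
      by (intro bounded_linear_compose[OF bounded_linear_cinner_left] blinfun.bounded_linear_right)
    from has_sum_bounded_linear[OF this orthonormal_basis_has_sum[OF S, of "b i"]]
    show ?thesis
      by (simp add: o_def BH_scaleC assms that cinner_scaleC_left mult.commute)
  qed
  then have "((\<lambda>e. \<Sum>i\<in>I. cinner (W i e) x * cinner (b i) e) has_sum (\<Sum>i\<in>I. cinner (W i (b i)) x)) S"
    by (induction I rule: infinite_finite_induct) (auto intro: has_sum_add)
  then have "((\<lambda>e. cinner (T e) e) has_sum (\<Sum>i\<in>I. cinner (W i (b i)) x)) S"
    by (simp add: T cinner_sum_left cinner_scaleC_left)
  then show ?thesis
    by (simp add: op_trace_def infsumI flip: S_def)
qed

text \<open>Idempotence gives \<open>E x = x\<close>, and self-adjointness then identifies the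
  coefficient of \<open>E y\<close> as \<open>cinner y x\<close>.\<close>

lemma projection_onto_line:
  fixes E :: "'a::complex_hilbert_space \<Rightarrow>\<^sub>L 'a"
  assumes E: "projection_onto E (range (\<lambda>c. c *\<^sub>C x))" and "norm x = 1"
  shows "E y = cinner y x *\<^sub>C x"
proof -
  have "E \<in> BH" and EE: "E o\<^sub>L E = E" and adj: "cadjoint E = E"
    and ran: "range (blinfun_apply E) = range (\<lambda>c. c *\<^sub>C x)"
    using E by (auto simp: projection_onto_def)
  have "x \<in> range (blinfun_apply E)"
    unfolding ran by (rule range_eqI[of _ _ 1]) simp
  then obtain z where "x = E z"
    by blast
  then have "E x = x"
    using EE blinfun_apply_blinfun_compose[of E E z] by simp
  obtain c where c: "E y = c *\<^sub>C x"
    using ran by blast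
  have "cinner (E y) x = cinner y (E x)"
    using cinner_cadjoint[OF \<open>E \<in> BH\<close>] adj by simp
  then have "c = cinner y x"
    using \<open>norm x = 1\<close> by (simp add: c \<open>E x = x\<close> cinner_scaleC_left cinner_self)
  then show ?thesis
    by (simp add: c)
qed

section \<open>Von Neumann algebras\<close>

lemma von_neumann_algebra_subset_BH: "von_neumann_algebra M \<Longrightarrow> M \<subseteq> BH"
  by (auto simp: von_neumann_algebra_def commutant_def)

lemma commutant_commute: "T \<in> commutant M \<Longrightarrow> A \<in> M \<Longrightarrow> T (A y) = A (T y)"
  by (simp add: commutant_def) (metis blinfun_apply_blinfun_compose)

lemma commutant_compose:
  assumes "S \<in> commutant M" "T \<in> commutant M"
  shows "S o\<^sub>L T \<in> commutant M"
  using assms commutant_commute[OF assms(1)] commutant_commute[OF assms(2)]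
  by (auto simp: commutant_def BH_compose intro!: blinfun_eqI)

text \<open>Take adjoints in the relation between \<open>T\<close> and \<open>cadjoint A\<close>,
  which commute because \<open>cadjoint A\<close> is again in \<open>M\<close>.\<close>

lemma cadjoint_commutant:
  fixes M :: "('a::complex_hilbert_space \<Rightarrow>\<^sub>L 'a) set"
  assumes "M \<subseteq> BH" and M: "\<And>A. A \<in> M \<Longrightarrow> cadjoint A \<in> M" and T: "T \<in> commutant M"
  shows "cadjoint T \<in> commutant M"
proof -
  have "T \<in> BH"
    using T by (simp add: commutant_def)
  have "cadjoint T (A z) = A (cadjoint T z)" if "A \<in> M" for A z
  proof (rule cinner_left_eqI)
    fix y
    have "A \<in> BH"
      using that \<open>M \<subseteq> BH\<close> by blast
    \<comment> \<open>\<open>A = A\<^sup>*\<^sup>*\<close>\<close>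
    have A: "cinner u (A v) = cinner (cadjoint A u) v" for u v
      using cinner_cadjoint[OF \<open>A \<in> BH\<close>, of v u] cinner_commute[of u "A v"]
        cinner_commute[of "cadjoint A u" v] by simp
    show "cinner y (cadjoint T (A z)) = cinner y (A (cadjoint T z))"
      using commutant_commute[OF T M[OF that]]
      by (simp add: A flip: cinner_cadjoint[OF \<open>T \<in> BH\<close>])
  qed
  then show ?thesis
    using cadjoint_BH[OF \<open>T \<in> BH\<close>] by (auto simp: commutant_def intro!: blinfun_eqI)
qed

text \<open>The closed orbit \<open>?V\<close> reduces every operator of the commutant, so its
  projection \<open>P\<close> lies in the bicommutant \<open>M\<close>. Then
  \<open>id_blinfun - P\<close> is an element of \<open>M\<close> that annihilates \<open>x\<close>,
  hence zero.\<close>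

lemma separating_imp_dense_commutant_orbit:
  fixes M :: "('a::complex_hilbert_space \<Rightarrow>\<^sub>L 'a) set"
  assumes vN: "von_neumann_algebra M" and sep: "separating_vector M x"
  shows "closure ((\<lambda>T. blinfun_apply T x) ` commutant M) = UNIV"
proof -
  let ?U = "(\<lambda>T. blinfun_apply T x) ` commutant M"
  let ?V = "closure ?U"
  have MBH: "M \<subseteq> BH" and adj: "\<And>A. A \<in> M \<Longrightarrow> cadjoint A \<in> M"
    and bicomm: "commutant (commutant M) = M"
    using vN von_neumann_algebra_subset_BH by (auto simp: von_neumann_algebra_def)
  have "subspace ?U"
  proof (rule subspaceI)
    have "0 \<in> commutant M"
      by (auto simp: commutant_def BH_def intro!: blinfun_eqI)
    then show "0 \<in> ?U"
      by (rule rev_image_eqI) simp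
    show "v + w \<in> ?U" if vw: "v \<in> ?U" "w \<in> ?U" for v w
    proof -
      obtain S T where ST: "S \<in> commutant M" "T \<in> commutant M" and eq: "v = S x" "w = T x"
        using vw by auto
      have "S + T \<in> commutant M"
        using ST commutant_commute[OF ST(1)] commutant_commute[OF ST(2)]
        by (auto simp: commutant_def BH_def blinfun.add_left blinfun.add_right scaleC_add_right
            intro!: blinfun_eqI)
      then show ?thesis
        by (rule rev_image_eqI) (simp add: eq blinfun.add_left)
    qed
    show "r *\<^sub>R v \<in> ?U" if v: "v \<in> ?U" for r v
    proof -
      obtain T where T: "T \<in> commutant M" and eq: "v = T x"
        using v by auto
      have "r *\<^sub>R T \<in> commutant M"
        using T commutant_commute[OF T]
        by (auto simp: commutant_def BH_scaleR blinfun.scaleR_left blinfun.scaleR_right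
            intro!: blinfun_eqI)
      then show ?thesis
        by (rule rev_image_eqI) (simp add: eq blinfun.scaleR_left)
    qed
  qed
  then obtain P :: "'a \<Rightarrow>\<^sub>L 'a" where PV: "\<And>y. P y \<in> ?V"
    and P: "\<And>y v. v \<in> ?V \<Longrightarrow> inner (y - P y) v = 0"
    using orthogonal_projection_exists[of ?V] subspace_closure by blast
  have V: "subspace ?V"
    using \<open>subspace ?U\<close> by (rule subspace_closure)
  have uniq: "P y = q" if "q \<in> ?V" and "\<And>v. v \<in> ?V \<Longrightarrow> inner (y - q) v = 0" for y q
    by (rule orthogonal_decomposition_unique[OF V PV P that])
  have V_inv: "T v \<in> ?V" if T: "T \<in> commutant M" and v: "v \<in> ?V" for T v
  proof -
    have "blinfun_apply T ` ?U \<subseteq> ?U"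
      by (auto intro!: rev_image_eqI[OF commutant_compose[OF T]])
    then have "blinfun_apply T ` ?V \<subseteq> ?V"
      by (intro image_closure_subset closed_closure order_trans[OF _ closure_subset])
        (auto intro!: continuous_intros)
    then show ?thesis
      using v by blast
  qed
  have P_comm: "P (T y) = T (P y)" if T: "T \<in> commutant M" for T y
  proof (rule uniq)
    show "T (P y) \<in> ?V"
      by (rule V_inv[OF T PV])
    fix v assume "v \<in> ?V"
    \<comment> \<open>The orthogonal complement of \<open>?V\<close> is invariant under
      \<open>T\<close> because \<open>?V\<close> is invariant under
      \<open>cadjoint T\<close>.\<close>
    then have "inner (y - P y) (cadjoint T v) = 0"
      by (intro P V_inv cadjoint_commutant MBH adj T)
    moreover have "inner (T (y - P y)) v = inner (y - P y) (cadjoint T v)"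
      using T by (simp add: inner_eq_Re_cinner cinner_cadjoint commutant_def)
    ultimately show "inner (T y - T (P y)) v = 0"
      by (simp add: blinfun.diff_right)
  qed
  \<comment> \<open>\<open>P\<close> was obtained as a projection in the real Hilbert space;
    commuting with the scalars makes it complex linear.\<close>
  have scaleC_comm: "Blinfun (\<lambda>y. c *\<^sub>C y) \<in> commutant M" for c
    using MBH by (auto simp: commutant_def BH_def bounded_linear_Blinfun_apply
        bounded_linear_scaleC_right scaleC_scaleC mult.commute intro!: blinfun_eqI)
  have "P \<in> BH"
    using P_comm[OF scaleC_comm] by (simp add: BH_def bounded_linear_Blinfun_apply bounded_linear_scaleC_right)
  have "id_blinfun - P \<in> commutant (commutant M)"
    unfolding commutant_def[of "commutant M"]
    using \<open>P \<in> BH\<close> by (auto simp: BH_def blinfun.diff_left blinfun.diff_right scaleC_diff_right P_comm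
        intro!: blinfun_eqI)
  then have IP: "id_blinfun - P \<in> M"
    by (simp add: bicomm)
  have "id_blinfun \<in> commutant M"
    by (auto simp: commutant_def BH_def intro!: blinfun_eqI)
  then have "x \<in> ?U"
    by (rule rev_image_eqI) simp
  then have "x \<in> ?V"
    using closure_subset[of ?U] by blast
  then have "P x = x"
    by (intro uniq) simp_all
  then have "(id_blinfun - P) x = 0"
    by (simp add: blinfun.diff_left)
  then have "id_blinfun - P = 0"
    using sep IP by (auto simp: separating_vector_def)
  then have "P y = y" for y
    by (metis blinfun_apply_id_blinfun id_apply right_minus_eq)
  then show ?thesis
    using PV by (metis UNIV_eq_I)
qed

section \<open>Positivity of \<open>\<phi>\<close> and the trace condition\<close>

theorem theorem10:
  fixes M :: "('a::complex_hilbert_space \<Rightarrow>\<^sub>L 'a) set"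
    and x :: 'a
    and E D :: "'a \<Rightarrow>\<^sub>L 'a"
    and k :: nat
    and A B :: "nat \<Rightarrow> 'a \<Rightarrow>\<^sub>L 'a"
    and \<phi> :: "('a \<Rightarrow>\<^sub>L 'a) \<Rightarrow> ('a \<Rightarrow>\<^sub>L 'a)"
  assumes "factor M"
    and "norm x = 1"
    and "separating_vector M x"
    and "cyclic_vector M x"
    and "projection_onto E (range (\<lambda>c. c *\<^sub>C x))"
    and "\<And>i. i \<in> {1..k} \<Longrightarrow> A i \<in> M"
    and "\<And>i. i \<in> {1..k} \<Longrightarrow> B i \<in> M"
    and "\<And>C. C \<in> M \<Longrightarrow> \<phi> C = (\<Sum>i=1..k. A i o\<^sub>L C o\<^sub>L B i)"
    and "D = (\<Sum>i=1..k. B i o\<^sub>L E o\<^sub>L A i)"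
  shows "positive_map M \<phi> \<longleftrightarrow>
    (\<forall>C D'. C \<in> M \<and> positive_op C \<and> D' \<in> commutant M \<and> positive_op D' \<longrightarrow>
      op_trace (D o\<^sub>L C o\<^sub>L D') \<in> \<real>\<^sub>\<ge>\<^sub>0)"
proof -
  note A = assms(6) and B = assms(7) and \<phi> = assms(8) and D = assms(9)
  have vN: "von_neumann_algebra M"
    using \<open>factor M\<close> by (simp add: factor_def)
  have MBH: "\<And>A. A \<in> M \<Longrightarrow> A \<in> BH" and adj: "\<And>A. A \<in> M \<Longrightarrow> cadjoint A \<in> M"
    using vN von_neumann_algebra_subset_BH by (auto simp: von_neumann_algebra_def)
  have \<phi>_apply: "\<phi> C y = (\<Sum>i=1..k. A i (C (B i y)))" if "C \<in> M" for C y
    by (simp add: \<phi>[OF that] blinfun.sum_left)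
  have \<phi>_BH: "\<phi> C \<in> BH" if "C \<in> M" for C
    unfolding \<phi>[OF that] by (intro BH_sum BH_compose MBH A B that)
  have \<phi>_comm: "\<phi> C (T y) = T (\<phi> C y)" if "C \<in> M" "T \<in> commutant M" for C T y
    using that A B
    by (simp add: \<phi>_apply blinfun.sum_right commutant_commute[OF that(2)])
  \<comment> \<open>The operator maps \<open>y\<close> to the sum of the vectors
    \<open>cinner (A i (C (T y))) x *\<^sub>C B i x\<close>. Its trace evaluates each functional at
    \<open>B i x\<close>, and \<open>T\<close> then moves past \<open>B i\<close> to form
    \<open>\<phi> C (T x)\<close>.\<close>
  have trace: "op_trace (D o\<^sub>L C o\<^sub>L T) = cinner (\<phi> C (T x)) x"
    if C: "C \<in> M" and T: "T \<in> commutant M" for C T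
  proof -
    have "op_trace (D o\<^sub>L C o\<^sub>L T) = (\<Sum>i=1..k. cinner ((A i o\<^sub>L C o\<^sub>L T) (B i x)) x)"
    proof (rule op_trace_finite_rank)
      show "A i o\<^sub>L C o\<^sub>L T \<in> BH" if "i \<in> {1..k}" for i
        using T MBH[OF A[OF that]] MBH[OF C] by (simp add: BH_compose commutant_def)
      show "(D o\<^sub>L C o\<^sub>L T) y = (\<Sum>i=1..k. cinner ((A i o\<^sub>L C o\<^sub>L T) y) x *\<^sub>C B i x)" for y
        using B by (simp add: D blinfun.sum_left projection_onto_line[OF assms(5,2)]
            BH_scaleC MBH)
    qed
    also have "\<dots> = (\<Sum>i=1..k. cinner (A i (C (B i (T x)))) x)"
      using B by (simp add: commutant_commute[OF T])
    finally show ?thesis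
      by (simp add: \<phi>_apply[OF C] cinner_sum_left)
  qed
  show ?thesis
  proof (intro iffI allI impI)
    fix C T
    assume "positive_map M \<phi>" and "C \<in> M \<and> positive_op C \<and> T \<in> commutant M \<and> positive_op T"
    then show "op_trace (D o\<^sub>L C o\<^sub>L T) \<in> \<real>\<^sub>\<ge>\<^sub>0"
      by (auto simp: positive_map_def trace \<phi>_comm
          intro!: cinner_commuting_positive blinfun_eqI simp flip: \<phi>_comm)
  next
    assume nonneg: "\<forall>C D'. C \<in> M \<and> positive_op C \<and> D' \<in> commutant M \<and> positive_op D' \<longrightarrow>
      op_trace (D o\<^sub>L C o\<^sub>L D') \<in> \<real>\<^sub>\<ge>\<^sub>0"
    show "positive_map M \<phi>"
      unfolding positive_map_def
    proof (intro ballI impI)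
      fix C
      assume C: "C \<in> M" "positive_op C"
      have orbit: "cinner (\<phi> C (T x)) (T x) \<in> \<real>\<^sub>\<ge>\<^sub>0" if T: "T \<in> commutant M" for T
      proof -
        have TBH: "T \<in> BH"
          using T by (simp add: commutant_def)
        have T': "cadjoint T \<in> commutant M"
          by (intro cadjoint_commutant subsetI MBH adj T)
        have cinner_T': "cinner (cadjoint T u) v = cinner u (T v)" for u v
          using cinner_cadjoint[OF TBH, of v u] cinner_commute[of u "T v"]
            cinner_commute[of "cadjoint T u" v] by simp
        have "positive_op (cadjoint T o\<^sub>L T)"
          by (simp add: positive_op_def BH_compose cadjoint_BH TBH cinner_T' cinner_self)
        \<comment> \<open>Here \<open>cadjoint T\<close> commutes with \<open>\<phi> C\<close>, so
          it can be pulled out and moved to the second argument, where it becomes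
          \<open>T\<close>.\<close>
        then have "cinner (\<phi> C ((cadjoint T o\<^sub>L T) x)) x \<in> \<real>\<^sub>\<ge>\<^sub>0"
          using nonneg C commutant_compose[OF T' T] trace by metis
        then show ?thesis
          by (simp add: \<phi>_comm[OF C(1) T'] cinner_T')
      qed
      \<comment> \<open>Nonnegativity passes from the dense orbit to every vector, since the
        quadratic form is continuous and the nonnegative reals are closed in the complex
        plane.\<close>
      have "cinner (\<phi> C y) y \<in> \<real>\<^sub>\<ge>\<^sub>0" for y
      proof -
        have "y \<in> closure ((\<lambda>T. blinfun_apply T x) ` commutant M)"
          using separating_imp_dense_commutant_orbit[OF vN assms(3)] by simp
        then obtain u where u_orbit: "\<And>n. u n \<in> (\<lambda>T. blinfun_apply T x) ` commutant M"
          and u: "u \<longlonglongrightarrow> y"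
          unfolding closure_sequential by blast
        have "cinner (\<phi> C (u n)) (u n) \<in> \<real>\<^sub>\<ge>\<^sub>0" for n
          using u_orbit[of n] by (auto simp: orbit)
        moreover have "(\<lambda>n. cinner (\<phi> C (u n)) (u n)) \<longlonglongrightarrow> cinner (\<phi> C y) y"
          by (intro tendsto_cinner blinfun.tendsto tendsto_const u)
        ultimately show ?thesis
          by (rule closed_sequentially[OF closed_nonneg_Reals_complex])
      qed
      then show "positive_op (\<phi> C)"
        using \<phi>_BH[OF C(1)] by (simp add: positive_op_def)
    qed
  qed
qed

end
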